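(* For every abstract BitML configuration $\Gamma^\sharp$, the set of abstract configurations reachable from $\Gamma^\sharp$ through $\to_{\sharp\mathit{fin}}$ is finite, up to renaming of contract names.
   Context: **Abstract contracts and configurations.** Fix participants $P,Q,\dots$, an infinite set of contract names $x,y,z,\dots$, and a finite set of recursion variables $\mathsf X,\mathsf Y,\dots$. Abstract contracts are $C ::= \sum_{i\in I}D_i$ ($I$ finite; $0$ is the empty sum), where abstract guarded contracts are $D ::= \mathtt{withdraw}\,P\mid\tau.C\mid\mathtt{split}\,\|_{i}(\to C_i)\mid{*}{:}D\mid{*}{:}\mathtt{rngt}\,\mathsf X$ (splits have finitely many components), with ${*}{:}{*}{:}D$ identified with ${*}{:}D$. (These terms are abstractions of BitML smart contracts w.r.t. a fixed honest participant $A$: a prefix ${*}{:}$ marks actions that may need the cooperation of participants other than $A$.) Each recursion variable $\mathsf X$ has a unique abstract defining equation $\mathsf X=_\sharp C$ with $C$ an abstract contract. Abstract configurations are finite parallel compositions ($|$ with unit $0$, a commutative monoid) of terms $\langle C\rangle_x$, with distinct names $x$, and of recursion variables $\mathsf X$ (possibly repeated). **Abstract semantics** $\Gamma\xrightarrow{\ell}_\sharp\Gamma'$, with labels $x$ or ${*}{:}x$ (${*}{:}{*}{:}\ell$ identified with ${*}{:}\ell$; $\mathrm{cn}(x)=\mathrm{cn}({*}{:}x)=\{x\}$), where $\Gamma$ is an arbitrary abstract configuration and "fresh" names are names not occurring so far: - $\langle\mathtt{withdraw}\,P\rangle_x|\Gamma\xrightarrow{x}_\sharp\Gamma$; - $\langle\tau.C\rangle_x|\Gamma\xrightarrow{x}_\sharp\langle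 C\rangle_y|\Gamma$, $y$ fresh; - $\langle\mathtt{split}\,\|_i(\to C_i)\rangle_x|\Gamma\xrightarrow{x}_\sharp\|_i\langle C_i\rangle_{y_i}|\Gamma$, $y_i$ fresh and distinct; - if $\langle D\rangle_x|\Gamma\xrightarrow{\ell}_\sharp\Gamma'$ and $x\in\mathrm{cn}(\ell)$, then $\langle D+C\rangle_x|\Gamma\xrightarrow{\ell}_\sharp\Gamma'$; - if $\langle D\rangle_x|\Gamma\xrightarrow{\ell}_\sharp\Gamma'$ and $x\in\mathrm{cn}(\ell)$, then $\langle{*}{:}D\rangle_x|\Gamma\xrightarrow{{*}:\ell}_\sharp\Gamma'$; - if $\mathsf X=_\sharp C$, then $\langle{*}{:}\mathtt{rngt}\,\mathsf X\rangle_x|\Gamma\xrightarrow{{*}:x}_\sharp\langle C\rangle_y|\mathsf X|\Gamma$, $y$ fresh. **Finite-state semantics.** $\Gamma\xrightarrow{\ell}_{\sharp\mathit{fin}}\Gamma'$ iff $\Gamma\xrightarrow{\ell}_\sharp\Gamma'$ and there are no $\Delta,\mathsf X$ with $\Gamma'=\Delta\,|\,\mathsf X\,|\,\mathsf X$ (i.e. no recursion variable occurs twice as a parallel component of $\Gamma'$). *)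

theory Defs
  imports "HOL-Library.Multiset" "HOL-Library.Infinite_Typeclass"
begin

text \<open>
  Finite sums and splits are families considered up to reindexing, i.e. finite multisets.
  The identification of \<open>*:*:D\<close> with \<open>*:D\<close> is built into the syntax: a guarded contract is
  either an unprefixed action or an action under exactly one \<open>*:\<close>, and \<open>rngt X\<close> only occurs
  under \<open>*:\<close>. The prefix operator \<open>*:\<close> on guarded contracts is the idempotent function
  \<open>star\<close> below.
\<close>

datatype ('p, 'v) action =
    Withdraw 'p
  | Tau "('p, 'v) contract"
  | Split "('p, 'v) contract multiset"
and ('p, 'v) guarded =
    Plain "('p, 'v) action"
  | Starred "('p, 'v) action"
  | StarRngt 'v
and ('p, 'v) contract =
    Sum "('p, 'v) guarded multiset"

fun star :: "('p, 'v) guarded \<Rightarrow> ('p, 'v) guarded" where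
  "star (Plain a) = Starred a"
| "star (Starred a) = Starred a"
| "star (StarRngt X) = StarRngt X"

lemma star_star: "star (star D) = star D"
  by (cases D) auto

abbreviation single :: "('p, 'v) guarded \<Rightarrow> ('p, 'v) contract" where
  "single D \<equiv> Sum {#D#}"

datatype 'n label = Lab 'n | StarLab 'n

fun star_label :: "'n label \<Rightarrow> 'n label" where
  "star_label (Lab x) = StarLab x"
| "star_label (StarLab x) = StarLab x"

fun cn :: "'n label \<Rightarrow> 'n set" where
  "cn (Lab x) = {x}"
| "cn (StarLab x) = {x}"

datatype ('p, 'v, 'n) component =
    Active "('p, 'v) contract" 'n
  | RecVar 'v

text \<open>
  Parallel composition is multiset union. Distinctness of contract names is the predicate
  \<open>abstract_config\<close>; it is preserved by all transitions (lemma \<open>abstract_config_step\<close>).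
\<close>

type_synonym ('p, 'v, 'n) config = "('p, 'v, 'n) component multiset"

fun component_names :: "('p, 'v, 'n) component \<Rightarrow> 'n multiset" where
  "component_names (Active C x) = {#x#}"
| "component_names (RecVar X) = {#}"

definition names_mset :: "('p, 'v, 'n) config \<Rightarrow> 'n multiset" where
  "names_mset \<Gamma> = (\<Sum>c\<in>#\<Gamma>. component_names c)"

abbreviation names :: "('p, 'v, 'n) config \<Rightarrow> 'n set" where
  "names \<Gamma> \<equiv> set_mset (names_mset \<Gamma>)"

definition abstract_config :: "('p, 'v, 'n) config \<Rightarrow> bool" where
  "abstract_config \<Gamma> \<longleftrightarrow> (\<forall>x. count (names_mset \<Gamma>) x \<le> 1)"

text \<open>
  The parameter \<open>eqs\<close> maps each recursion variable to the right-hand side of its unique defining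
  equation. A fresh name is one that does not occur in the source configuration of the transition.
\<close>

inductive step ::
  "('v \<Rightarrow> ('p, 'v) contract) \<Rightarrow> ('p, 'v, 'n) config \<Rightarrow> 'n label \<Rightarrow> ('p, 'v, 'n) config \<Rightarrow> bool"
  for eqs :: "'v \<Rightarrow> ('p, 'v) contract" where
  withdraw:
    "step eqs ({#Active (single (Plain (Withdraw P))) x#} + \<Gamma>) (Lab x) \<Gamma>"
| tau:
    "y \<notin> insert x (names \<Gamma>) \<Longrightarrow>
     step eqs ({#Active (single (Plain (Tau C))) x#} + \<Gamma>) (Lab x) ({#Active C y#} + \<Gamma>)"
| split:
    "length ys = length Cs \<Longrightarrow> distinct ys \<Longrightarrow> set ys \<inter> insert x (names \<Gamma>) = {} \<Longrightarrow>
     step eqs ({#Active (single (Plain (Split (mset Cs)))) x#} + \<Gamma>) (Lab x)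
       (mset (map2 Active Cs ys) + \<Gamma>)"
| sum:
    "step eqs ({#Active (single D) x#} + \<Gamma>) l \<Gamma>' \<Longrightarrow> x \<in> cn l \<Longrightarrow>
     step eqs ({#Active (Sum ({#D#} + Ds)) x#} + \<Gamma>) l \<Gamma>'"
| star:
    "step eqs ({#Active (single D) x#} + \<Gamma>) l \<Gamma>' \<Longrightarrow> x \<in> cn l \<Longrightarrow>
     step eqs ({#Active (single (star D)) x#} + \<Gamma>) (star_label l) \<Gamma>'"
| rngt:
    "y \<notin> insert x (names \<Gamma>) \<Longrightarrow>
     step eqs ({#Active (single (StarRngt X)) x#} + \<Gamma>) (StarLab x)
       ({#Active (eqs X) y#} + {#RecVar X#} + \<Gamma>)"

definition step_fin ::
  "('v \<Rightarrow> ('p, 'v) contract) \<Rightarrow> ('p, 'v, 'n) config \<Rightarrow> 'n label \<Rightarrow> ('p, 'v, 'n) config \<Rightarrow> bool"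
  where
  "step_fin eqs \<Gamma> l \<Gamma>' \<longleftrightarrow>
     step eqs \<Gamma> l \<Gamma>' \<and> \<not> (\<exists>\<Delta> X. \<Gamma>' = \<Delta> + {#RecVar X#} + {#RecVar X#})"

definition reachable_fin ::
  "('v \<Rightarrow> ('p, 'v) contract) \<Rightarrow> ('p, 'v, 'n) config \<Rightarrow> ('p, 'v, 'n) config set" where
  "reachable_fin eqs \<Gamma> = {\<Gamma>'. (\<lambda>\<Delta> \<Delta>'. \<exists>l. step_fin eqs \<Delta> l \<Delta>')\<^sup>*\<^sup>* \<Gamma> \<Gamma>'}"

fun rename_component :: "('n \<Rightarrow> 'n) \<Rightarrow> ('p, 'v, 'n) component \<Rightarrow> ('p, 'v, 'n) component" where
  "rename_component \<pi> (Active C x) = Active C (\<pi> x)"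
| "rename_component \<pi> (RecVar X) = RecVar X"

definition renaming_rel :: "(('p, 'v, 'n) config \<times> ('p, 'v, 'n) config) set" where
  "renaming_rel = {(\<Gamma>, \<Gamma>'). \<exists>\<pi>. bij \<pi> \<and> \<Gamma>' = image_mset (rename_component \<pi>) \<Gamma>}"

lemma rename_component_id: "rename_component id = id"
  apply (rule ext)
  subgoal for c by (cases c) auto
  done

lemma rename_component_comp:
  "rename_component g \<circ> rename_component f = rename_component (g \<circ> f)"
  apply (rule ext)
  subgoal for c by (cases c) auto
  done

lemma equiv_renaming_rel:
  "equiv UNIV (renaming_rel :: (('p, 'v, 'n) config \<times> ('p, 'v, 'n) config) set)"
  (is "equiv UNIV ?R")
proof (rule equivI)
  show "?R \<subseteq> UNIV \<times> UNIV" by simp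
  show "refl ?R"
  proof (rule refl_onI)
    show "(\<Gamma>, \<Gamma>) \<in> renaming_rel" for \<Gamma> :: "('p, 'v, 'n) config"
      by (auto simp: renaming_rel_def rename_component_id intro!: exI[of _ id])
  qed
  show "sym ?R"
  proof (rule symI)
    fix \<Gamma> \<Gamma>' :: "('p, 'v, 'n) config"
    assume "(\<Gamma>, \<Gamma>') \<in> renaming_rel"
    then obtain \<pi> where \<pi>: "bij \<pi>" "\<Gamma>' = image_mset (rename_component \<pi>) \<Gamma>"
      by (auto simp: renaming_rel_def)
    have "image_mset (rename_component (inv \<pi>)) \<Gamma>' = \<Gamma>"
      unfolding \<pi>(2) multiset.map_comp rename_component_comp
      using \<pi>(1) by (simp add: bij_is_inj rename_component_id)
    with bij_imp_bij_inv[OF \<pi>(1)] show "(\<Gamma>', \<Gamma>) \<in> renaming_rel"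
      by (auto simp: renaming_rel_def intro!: exI[of _ "inv \<pi>"])
  qed
  show "trans ?R"
  proof (rule transI)
    fix \<Gamma>1 \<Gamma>2 \<Gamma>3 :: "('p, 'v, 'n) config"
    assume "(\<Gamma>1, \<Gamma>2) \<in> renaming_rel" "(\<Gamma>2, \<Gamma>3) \<in> renaming_rel"
    then obtain f g where "bij f" "\<Gamma>2 = image_mset (rename_component f) \<Gamma>1"
      and "bij g" "\<Gamma>3 = image_mset (rename_component g) \<Gamma>2"
      by (auto simp: renaming_rel_def)
    then have "bij (g \<circ> f)" "\<Gamma>3 = image_mset (rename_component (g \<circ> f)) \<Gamma>1"
      by (simp_all add: bij_comp multiset.map_comp rename_component_comp)
    then show "(\<Gamma>1, \<Gamma>3) \<in> renaming_rel"
      unfolding renaming_rel_def by blast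
  qed
qed

lemma names_mset_simps [simp]:
  "names_mset {#} = {#}"
  "names_mset (add_mset c \<Gamma>) = component_names c + names_mset \<Gamma>"
  "names_mset (\<Gamma> + \<Delta>) = names_mset \<Gamma> + names_mset \<Delta>"
  by (simp_all add: names_mset_def)

lemma names_mset_map2:
  "length ys = length Cs \<Longrightarrow> names_mset (mset (map2 Active Cs ys)) = mset ys"
  by (induction ys Cs rule: list_induct2) auto

lemma abstract_config_Active [simp]:
  fixes x :: 'n
  shows "abstract_config (add_mset (Active C x) \<Gamma>) \<longleftrightarrow> x \<notin> names \<Gamma> \<and> abstract_config \<Gamma>"
proof -
  have "(\<forall>z. count (add_mset x M) z \<le> 1) \<longleftrightarrow> x \<notin># M \<and> (\<forall>z. count M z \<le> 1)" (is "?L \<longleftrightarrow> ?R")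
    for M :: "'n multiset"
  proof
    assume L: ?L
    have "count M z \<le> 1" for z
      using L[rule_format, of z] by (simp split: if_splits)
    moreover have "count M x = 0"
      using L[rule_format, of x] by simp
    ultimately show ?R
      by (simp add: count_eq_zero_iff)
  next
    assume R: ?R
    then have "count M x = 0"
      by (simp add: count_eq_zero_iff)
    with R show ?L by simp
  qed
  from this[of "names_mset \<Gamma>"] show ?thesis
    by (simp add: abstract_config_def)
qed

lemma abstract_config_RecVar [simp]:
  "abstract_config (add_mset (RecVar X) \<Gamma>) \<longleftrightarrow> abstract_config \<Gamma>"
  by (simp add: abstract_config_def)

lemma abstract_config_map2:
  "length ys = length Cs \<Longrightarrow> distinct ys \<Longrightarrow> set ys \<inter> names \<Gamma> = {} \<Longrightarrow> abstract_config \<Gamma> \<Longrightarrow>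
   abstract_config (mset (map2 Active Cs ys) + \<Gamma>)"
proof (induction ys Cs rule: list_induct2)
  case (Cons y ys C Cs)
  then show ?case
    using names_mset_map2[OF Cons.hyps] by simp
qed simp

lemma abstract_config_step:
  assumes "step eqs \<Gamma> l \<Gamma>'" and "abstract_config \<Gamma>"
  shows "abstract_config \<Gamma>'"
  using assms
proof (induction rule: step.induct)
  case (split ys Cs x \<Gamma>)
  then show ?case by (intro abstract_config_map2) auto
qed simp_all

end

theory Submission
  imports Defs
begin

text \<open>
  Erase all contract names. A step replaces one active contract by the outcome of one of its
  summands, so on erased configurations the transition relation is finitely branching. It also
  terminates: a non-recursive step strictly decreases the total size of the active contracts, and a
  step unfolding \<open>X\<close> is allowed only if \<open>X\<close> is not yet a component, so the size of \<open>eqs X\<close> can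
  be charged in advance to each \<open>X\<close> that is still absent. Hence only finitely many erased
  configurations are reachable, and two abstract configurations with the same erasure differ by a
  renaming.
\<close>

section \<open>Finiteness criteria and extension of injections\<close>

text \<open>By induction on the measure, the reachable set is \<open>x\<close> together with
  finitely many sets that are finite already.\<close>

lemma finite_reachable_if_decreasing:
  fixes m :: "'a \<Rightarrow> nat"
  assumes branching: "\<And>x. finite {y. R x y}" and decreasing: "\<And>x y. R x y \<Longrightarrow> m y < m x"
  shows "finite {y. R\<^sup>*\<^sup>* x y}"
proof (induction "m x" arbitrary: x rule: less_induct)
  case less
  have "{y. R\<^sup>*\<^sup>* x y} \<subseteq> insert x (\<Union>y\<in>{y. R x y}. {z. R\<^sup>*\<^sup>* y z})"
    by (auto elim: converse_rtranclpE)
  moreover have "finite \<dots>"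
    using branching decreasing less by simp
  ultimately show ?case
    by (rule finite_subset)
qed

text \<open>A class is determined by the value of \<open>f\<close> at any of its representatives in
  \<open>A\<close>; \<open>inv_into\<close> picks a representative back from that value.\<close>

lemma finite_quotient_if_finite_image:
  assumes "equiv UNIV r" and "finite (f ` A)"
    and "\<And>x y. x \<in> A \<Longrightarrow> y \<in> A \<Longrightarrow> f x = f y \<Longrightarrow> (x, y) \<in> r"
  shows "finite (A // r)"
proof (rule finite_surj)
  show "finite (f ` A)" by fact
  show "A // r \<subseteq> (\<lambda>b. r `` {inv_into A f b}) ` f ` A"
  proof
    fix K assume "K \<in> A // r"
    then obtain x where x: "x \<in> A" "K = r `` {x}"
      by (auto elim: quotientE)
    then have "(x, inv_into A f (f x)) \<in> r"
      by (intro assms(3)) (auto simp: inv_into_into f_inv_into_f)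
    then have "K = r `` {inv_into A f (f x)}"
      unfolding x(2) by (rule equiv_class_eq[OF assms(1)])
    with x(1) show "K \<in> (\<lambda>b. r `` {inv_into A f b}) ` f ` A"
      by blast
  qed
qed

text \<open>\<open>renaming_rel\<close> asks for a bijection of all names, whereas matching two
  configurations yields an injection on finitely many names only.\<close>

lemma inj_on_finite_extends_to_bij:
  fixes f :: "'a \<Rightarrow> 'a"
  assumes "finite A" and "inj_on f A"
  obtains \<pi> where "bij \<pi>" and "\<And>x. x \<in> A \<Longrightarrow> \<pi> x = f x"
proof -
  let ?B = "f ` A"
  \<comment> \<open>The points of \<open>?B\<close> that have no value yet are as many as the points
    of \<open>A\<close> not hit yet, so \<open>g\<close> can match them; the identity serves
    elsewhere.\<close>
  have "card (?B - A) = card (A - ?B)"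
    using assms card_image[OF assms(2)]
      card_Diff_subset_Int[of ?B A] card_Diff_subset_Int[of A ?B] by (simp add: Int_commute)
  then obtain g where g: "bij_betw g (?B - A) (A - ?B)"
    using assms(1) by (meson finite_Diff finite_imageI finite_same_card_bij)
  let ?\<pi> = "\<lambda>x. if x \<in> A then f x else if x \<in> ?B then g x else x"
  have "bij_betw ?\<pi> A ?B"
    using assms(2) by (simp add: bij_betw_def cong: inj_on_cong)
  moreover have "bij_betw ?\<pi> (?B - A) (A - ?B)"
    using g by (rule bij_betw_cong[THEN iffD1, rotated]) auto
  ultimately have "bij_betw ?\<pi> (A \<union> (?B - A)) (?B \<union> (A - ?B))"
    by (rule bij_betw_combine) blast
  moreover have "bij_betw ?\<pi> (- (A \<union> ?B)) (- (A \<union> ?B))"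
    by (rule bij_betw_cong[THEN iffD1, OF _ bij_betw_id]) auto
  ultimately have "bij_betw ?\<pi> (A \<union> (?B - A) \<union> - (A \<union> ?B)) (?B \<union> (A - ?B) \<union> - (A \<union> ?B))"
    by (rule bij_betw_combine) blast
  moreover have "A \<union> (?B - A) \<union> - (A \<union> ?B) = UNIV" "?B \<union> (A - ?B) \<union> - (A \<union> ?B) = UNIV"
    by auto
  ultimately have "bij ?\<pi>"
    by simp
  then show ?thesis
    by (rule that) simp
qed

section \<open>Erasure of names and recovery of renamings\<close>

text \<open>Collapsing all names to \<open>undefined\<close> stays within the type
  \<open>config\<close>, although the result is in general no
  \<open>abstract_config\<close>.\<close>

abbreviation erase :: "('p, 'v, 'n) config \<Rightarrow> ('p, 'v, 'n) config" where
  "erase \<Gamma> \<equiv> image_mset (rename_component (\<lambda>_. undefined)) \<Gamma>"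

lemma rename_component_eq_RecVar [simp]:
  "rename_component f c = RecVar X \<longleftrightarrow> c = RecVar X"
  by (cases c) auto

lemma rename_component_eq_Active:
  "rename_component f c = Active C y \<longleftrightarrow> (\<exists>x. c = Active C x \<and> f x = y)"
  by (cases c) auto

lemma erase_eq_add_RecVar:
  assumes "erase \<Gamma> = add_mset (RecVar X) S"
  obtains \<Delta> where "\<Gamma> = add_mset (RecVar X) \<Delta>" and "erase \<Delta> = S"
  using msed_map_invR[OF assms] by auto

lemma erase_map2_Active:
  "length ys = length Cs \<Longrightarrow>
   erase (mset (map2 Active Cs ys)) = image_mset (\<lambda>C. Active C undefined) (mset Cs)"
  by (induction ys Cs rule: list_induct2) auto

lemma Active_in_config_name: "Active C x \<in># \<Gamma> \<Longrightarrow> x \<in> names \<Gamma>"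
  by (auto dest!: multi_member_split)

lemma add_mset_Active_eq:
  "add_mset (Active B x) \<Gamma> = add_mset (Active C x) \<Delta> \<Longrightarrow> x \<notin> names \<Gamma> \<Longrightarrow> C = B \<and> \<Delta> = \<Gamma>"
  using Active_in_config_name[of C x \<Gamma>] by (auto simp: add_eq_conv_ex)

text \<open>Components are matched one by one, extending \<open>f\<close> by one pair of names for
  each active contract. The clause on the image of \<open>f\<close> serves the induction: it shows
  that the new value is not taken yet.\<close>

lemma erase_eq_imp_inj_on:
  assumes "abstract_config \<Gamma>" and "abstract_config \<Delta>" and "erase \<Gamma> = erase \<Delta>"
  shows "\<exists>f. inj_on f (names \<Gamma>) \<and> f ` names \<Gamma> = names \<Delta> \<and>
    \<Delta> = image_mset (rename_component f) \<Gamma>"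
  using assms
proof (induction \<Gamma> arbitrary: \<Delta>)
  case empty
  then show ?case by simp
next
  case (add c \<Gamma>)
  from add.prems(3) obtain d \<Delta>' where \<Delta>: "\<Delta> = add_mset d \<Delta>'" "erase \<Gamma> = erase \<Delta>'"
    and cd: "rename_component (\<lambda>_. undefined) d = rename_component (\<lambda>_. undefined) c"
    using msed_map_invR[OF add.prems(3)[simplified, symmetric]] by auto
  show ?case
  proof (cases c)
    case (RecVar X)
    with cd have "d = RecVar X" by simp
    with add.IH[of \<Delta>'] add.prems \<Delta> RecVar show ?thesis by simp
  next
    case (Active C x)
    with cd obtain y where d: "d = Active C y"
      by (auto simp: rename_component_eq_Active)
    from add.prems Active d \<Delta> have x: "x \<notin> names \<Gamma>" and y: "y \<notin> names \<Delta>'"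
      and "abstract_config \<Gamma>" "abstract_config \<Delta>'"
      by simp_all
    with add.IH \<Delta>(2) obtain f where f: "inj_on f (names \<Gamma>)" "f ` names \<Gamma> = names \<Delta>'"
      "\<Delta>' = image_mset (rename_component f) \<Gamma>"
      by blast
    let ?f = "f(x := y)"
    have "rename_component ?f c' = rename_component f c'" if "c' \<in># \<Gamma>" for c'
      using that x Active_in_config_name by (cases c') fastforce+
    then have "image_mset (rename_component ?f) \<Gamma> = \<Delta>'"
      unfolding f(3) by (rule image_mset_cong)
    moreover have "inj_on ?f (names (add_mset c \<Gamma>))"
      using f(1,2) x y by (auto simp: Active inj_on_def)
    moreover have "?f ` names (add_mset c \<Gamma>) = names \<Delta>"
      using f(2) x by (auto simp: Active d \<Delta>(1))
    moreover have "\<Delta> = image_mset (rename_component ?f) (add_mset c \<Gamma>)"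
      using \<open>image_mset (rename_component ?f) \<Gamma> = \<Delta>'\<close> by (simp add: Active d \<Delta>(1))
    ultimately show ?thesis
      by blast
  qed
qed

lemma erase_eq_imp_renaming:
  assumes "abstract_config \<Gamma>" and "abstract_config \<Delta>" and "erase \<Gamma> = erase \<Delta>"
  shows "(\<Gamma>, \<Delta>) \<in> renaming_rel"
proof -
  from erase_eq_imp_inj_on[OF assms] obtain f
    where f: "inj_on f (names \<Gamma>)" "\<Delta> = image_mset (rename_component f) \<Gamma>"
    by blast
  obtain \<pi> where \<pi>: "bij \<pi>" "\<And>x. x \<in> names \<Gamma> \<Longrightarrow> \<pi> x = f x"
    using inj_on_finite_extends_to_bij[OF _ f(1)] by blast
  have "rename_component f c = rename_component \<pi> c" if "c \<in># \<Gamma>" for c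
    using that \<pi>(2) Active_in_config_name by (cases c) fastforce+
  then have "\<Delta> = image_mset (rename_component \<pi>) \<Gamma>"
    unfolding f(2) by (rule image_mset_cong)
  with \<pi>(1) show ?thesis
    unfolding renaming_rel_def by blast
qed

section \<open>Effect of a transition on erased configurations\<close>

fun summands :: "('p, 'v) contract \<Rightarrow> ('p, 'v) guarded set" where
  "summands (Sum Ds) = set_mset Ds"

text \<open>The residual components are produced in erased form, hence \<open>undefined\<close>
  where the semantics picks fresh names.\<close>

fun action_outcome :: "('p, 'v) action \<Rightarrow> ('p, 'v, 'n) config" where
  "action_outcome (Withdraw P) = {#}"
| "action_outcome (Tau C) = {#Active C undefined#}"
| "action_outcome (Split Cs) = image_mset (\<lambda>C. Active C undefined) Cs"

fun outcome ::
  "('v \<Rightarrow> ('p, 'v) contract) \<Rightarrow> ('p, 'v) guarded \<Rightarrow> ('p, 'v, 'n) config" where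
  "outcome eqs (Plain a) = action_outcome a"
| "outcome eqs (Starred a) = action_outcome a"
| "outcome eqs (StarRngt X) = {#Active (eqs X) undefined, RecVar X#}"

lemma outcome_star [simp]: "outcome eqs (star D) = outcome eqs D"
  by (cases D) auto

text \<open>
  Distinctness of names is essential for the rules \<open>sum\<close> and \<open>star\<close>: it makes the component that
  fires in the premise the one that the rule modifies.
\<close>

lemma step_erase:
  assumes "step eqs \<Gamma> l \<Gamma>'" and "abstract_config \<Gamma>"
  shows "\<exists>C x \<Delta> D. cn l = {x} \<and> \<Gamma> = add_mset (Active C x) \<Delta> \<and> D \<in> summands C \<and>
    erase \<Gamma>' = outcome eqs D + erase \<Delta>"
  using assms
proof (induction rule: step.induct)
  case (withdraw P x \<Gamma>)
  show ?case
    by (intro exI[of _ "single (Plain (Withdraw P))"] exI[of _ x] exI[of _ \<Gamma>]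
        exI[of _ "Plain (Withdraw P)"]) simp
next
  case (tau y x \<Gamma> C)
  show ?case
    by (intro exI[of _ "single (Plain (Tau C))"] exI[of _ x] exI[of _ \<Gamma>]
        exI[of _ "Plain (Tau C)"]) simp
next
  case (split ys Cs x \<Gamma>)
  then show ?case
    by (intro exI[of _ "single (Plain (Split (mset Cs)))"] exI[of _ x] exI[of _ \<Gamma>]
        exI[of _ "Plain (Split (mset Cs))"]) (simp add: erase_map2_Active del: mset_map)
next
  case (sum D x \<Gamma> l \<Gamma>' Ds)
  then have "x \<notin> names \<Gamma>" "abstract_config \<Gamma>" by simp_all
  \<comment> \<open>Since \<open>cn l\<close> is a singleton containing \<open>x\<close>, the name
    fired in the premise is \<open>x\<close>; its contract is then \<open>single D\<close>, whose
    only summand is \<open>D\<close>.\<close>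
  with sum.IH sum.hyps(2) have "erase \<Gamma>' = outcome eqs D + erase \<Gamma> \<and> cn l = {x}"
    by (auto dest!: add_mset_Active_eq)
  then show ?case
    by (intro exI[of _ "Sum ({#D#} + Ds)"] exI[of _ x] exI[of _ \<Gamma>] exI[of _ D]) simp
next
  case (star D x \<Gamma> l \<Gamma>')
  then have "x \<notin> names \<Gamma>" "abstract_config \<Gamma>" by simp_all
  with star.IH star.hyps(2) have "erase \<Gamma>' = outcome eqs D + erase \<Gamma> \<and> cn l = {x}"
    by (auto dest!: add_mset_Active_eq)
  moreover have "cn (star_label l) = cn l"
    by (cases l) auto
  ultimately show ?case
    by (intro exI[of _ "single (star D)"] exI[of _ x] exI[of _ \<Gamma>] exI[of _ "star D"]) simp
next
  case (rngt y x \<Gamma> X)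
  show ?case
    by (intro exI[of _ "single (StarRngt X)"] exI[of _ x] exI[of _ \<Gamma>]
        exI[of _ "StarRngt X"]) simp
qed

section \<open>A potential that decreases along transitions\<close>

fun component_size :: "('p, 'v, 'n) component \<Rightarrow> nat" where
  "component_size (Active C x) = size C"
| "component_size (RecVar X) = 0"

text \<open>Finiteness of \<open>'v\<close> matters for the second sum: over an infinite index set
  it would be 0 by convention.\<close>

definition potential ::
  "('v::finite \<Rightarrow> ('p, 'v) contract) \<Rightarrow> ('p, 'v, 'n) config \<Rightarrow> nat" where
  "potential eqs \<Gamma> =
     (\<Sum>c\<in>#\<Gamma>. component_size c) + (\<Sum>X | RecVar X \<notin># \<Gamma>. Suc (size (eqs X)))"

text \<open>The size of a split is computed through \<open>size_multiset\<close>, which counts one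
  more for each branch and so dominates the plain sum of sizes.\<close>

lemma size_action_outcome:
  fixes a :: "('p, 'v) action"
  shows "(\<Sum>c\<in>#(action_outcome a :: ('p, 'v, 'n) config). component_size c) \<le> size a"
proof (cases a)
  case (Split Cs)
  have "(\<Sum>C\<in>#Cs. size C) \<le> size_multiset size Cs"
    by (induction Cs) auto
  with Split show ?thesis
    by (simp add: multiset.map_comp comp_def)
qed simp_all

lemma size_summand_less: "D \<in> summands C \<Longrightarrow> size D < size C"
  by (cases C) (auto dest!: multi_member_split)

lemma RecVar_notin_action_outcome [simp]: "RecVar X \<notin># action_outcome a"
  by (cases a) auto

lemma potential_decreases:
  fixes S :: "('a, 'b::finite, 'c) config"
  assumes "D \<in> summands C" and norep: "\<nexists>T X. outcome eqs D + S = T + {#RecVar X, RecVar X#}"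
  shows "potential eqs (outcome eqs D + S) < potential eqs (add_mset (Active C x) S)"
proof -
  note size_summand_less[OF assms(1)]
  moreover have ?thesis if "outcome eqs D = (action_outcome a :: ('a, 'b, 'c) config)" "size a \<le> size D" for a
    using that size_action_outcome[where 'n = 'c, of a] \<open>size D < size C\<close> by (simp add: potential_def)
  moreover have ?thesis if "D = StarRngt X" for X
  proof -
    \<comment> \<open>Otherwise the unfolding would create a second copy of \<open>X\<close>,
      against \<open>norep\<close>.\<close>
    have "RecVar X \<notin># S"
    proof
      assume "RecVar X \<in># S"
      then obtain T where "S = add_mset (RecVar X) T"
        by (blast dest: multi_member_split)
      with that have "outcome eqs D + S = add_mset (Active (eqs X) undefined) T + {#RecVar X, RecVar X#}"
        by simp
      with norep show False by blast
    qed
    \<comment> \<open>This isolates the charge for \<open>X\<close>, which is released once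
      \<open>X\<close> is a component and pays for the new copy of \<open>eqs X\<close>.\<close>
    then have "{Y. RecVar Y \<notin># S} = insert X {Y. Y \<noteq> X \<and> RecVar Y \<notin># S}"
      by auto
    with that \<open>size D < size C\<close> show ?thesis
      by (simp add: potential_def)
  qed
  ultimately show ?thesis
    by (cases D) auto
qed

section \<open>Finite branching and simulation of the finite-state semantics\<close>

definition successors ::
  "('v \<Rightarrow> ('p, 'v) contract) \<Rightarrow> ('p, 'v, 'n) config \<Rightarrow> ('p, 'v, 'n) config set" where
  "successors eqs S = {outcome eqs D + T | C x T D. S = add_mset (Active C x) T \<and> D \<in> summands C}"

text \<open>A successor is fixed by the choice of a component of \<open>S\<close> and of one of its
  summands.\<close>

lemma finite_successors: "finite (successors eqs S)"
proof (rule finite_subset)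
  let ?ds = "\<lambda>c. case c of Active C x \<Rightarrow> summands C | RecVar X \<Rightarrow> {}"
  show "successors eqs S \<subseteq> (\<Union>c\<in>set_mset S. (\<lambda>D. outcome eqs D + (S - {#c#})) ` ?ds c)"
    by (fastforce simp: successors_def)
  have "finite (summands C)" for C :: "('a, 'b) contract"
    by (cases C) simp
  then show "finite (\<Union>c\<in>set_mset S. (\<lambda>D. outcome eqs D + (S - {#c#})) ` ?ds c)"
    by (auto split: component.split)
qed

lemma step_fin_erase:
  assumes "step_fin eqs \<Gamma> l \<Gamma>'" and "abstract_config \<Gamma>"
  shows "erase \<Gamma>' \<in> successors eqs (erase \<Gamma>)"
    and "potential eqs (erase \<Gamma>') < potential eqs (erase \<Gamma>)"
proof -
  from assms obtain C x \<Delta> D where \<Gamma>: "\<Gamma> = add_mset (Active C x) \<Delta>" and D: "D \<in> summands C"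
    and \<Gamma>': "erase \<Gamma>' = outcome eqs D + erase \<Delta>"
    using step_erase unfolding step_fin_def by metis
  from \<Gamma> D \<Gamma>' show "erase \<Gamma>' \<in> successors eqs (erase \<Gamma>)"
    unfolding successors_def by auto
  \<comment> \<open>Erasure leaves recursion variables untouched, so a repetition after erasure
    comes from one in \<open>\<Gamma>'\<close>.\<close>
  have "\<nexists>T X. erase \<Gamma>' = T + {#RecVar X, RecVar X#}"
  proof clarify
    fix T X assume "erase \<Gamma>' = T + {#RecVar X, RecVar X#}"
    then obtain \<Theta> where "\<Gamma>' = add_mset (RecVar X) (add_mset (RecVar X) \<Theta>)"
      by (auto elim!: erase_eq_add_RecVar)
    then have "\<Gamma>' = \<Theta> + {#RecVar X#} + {#RecVar X#}"
      by simp
    with assms(1) show False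
      unfolding step_fin_def by blast
  qed
  with D show "potential eqs (erase \<Gamma>') < potential eqs (erase \<Gamma>)"
    unfolding \<Gamma> \<Gamma>' by (simp add: potential_decreases)
qed

theorem theorem5p8:
  fixes eqs :: "'v::finite \<Rightarrow> ('p, 'v) contract"
    and \<Gamma> :: "('p, 'v, 'n::infinite) config"
  assumes "abstract_config \<Gamma>"
  shows "finite (reachable_fin eqs \<Gamma> // renaming_rel)"
proof (rule finite_quotient_if_finite_image[where f = erase])
  \<comment> \<open>The decrease is made part of the relation because \<open>successors\<close>
    alone also admits steps that repeat a recursion variable, and these can go on forever.\<close>
  let ?R = "\<lambda>S S' :: ('p, 'v, 'n) config.
    S' \<in> successors eqs S \<and> potential eqs S' < potential eqs S"
  \<comment> \<open>Distinctness of names is carried along: both the simulation of each step and the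
    final recovery of a renaming rely on it.\<close>
  have reach: "abstract_config \<Delta> \<and> ?R\<^sup>*\<^sup>* (erase \<Gamma>) (erase \<Delta>)"
    if "\<Delta> \<in> reachable_fin eqs \<Gamma>" for \<Delta>
    using that unfolding reachable_fin_def mem_Collect_eq
  proof (induction rule: rtranclp_induct)
    case base
    with assms show ?case by simp
  next
    case (step \<Delta> \<Delta>')
    then obtain l where l: "step_fin eqs \<Delta> l \<Delta>'" by blast
    with step.IH have "abstract_config \<Delta>'"
      unfolding step_fin_def by (blast intro: abstract_config_step)
    with step.IH step_fin_erase[OF l] show ?case
      by (auto intro: rtranclp.rtrancl_into_rtrancl[of ?R])
  qed
  have "finite {S. ?R\<^sup>*\<^sup>* (erase \<Gamma>) S}"
    by (rule finite_reachable_if_decreasing[where m = "potential eqs"])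
      (auto intro: finite_subset[OF _ finite_successors])
  then show "finite (erase ` reachable_fin eqs \<Gamma>)"
    by (rule rev_finite_subset) (use reach in blast)
  show "(\<Delta>, \<Delta>') \<in> renaming_rel"
    if "\<Delta> \<in> reachable_fin eqs \<Gamma>" "\<Delta>' \<in> reachable_fin eqs \<Gamma>" "erase \<Delta> = erase \<Delta>'" for \<Delta> \<Delta>'
    using that reach by (blast intro: erase_eq_imp_renaming)
qed (rule equiv_renaming_rel)

end
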